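(* Let $p$ be a prime and $m\in\mathbb N$ with $p\nmid m$. Write $\Phi_{mp}(z)=\sum_{k=0}^{(p-1)\varphi(m)}a_{mp}(k)z^{(p-1)\varphi(m)-k}$ and $\Phi_m(z)=\sum_{s=0}^{\varphi(m)}a_m(s)z^{\varphi(m)-s}$. Then for every $k\in\{0,1,\ldots,(p-1)\varphi(m)\}$, $$a_{mp}(k)=\sum_{s=0}^{[k/p]}a_m(s)\,\mathcal H_{k-sp}(\vec\zeta_m^{\,*}).$$
   Context: $\Phi_n(z)=\prod_{1\le j\le n,\ (j,n)=1}(z-\zeta_n^j)$ with $\zeta_n=e^{2\pi i/n}$ is the $n$th cyclotomic polynomial; $\varphi$ is Euler's totient function and $[x]$ is the integer part of $x$. For $r\in\mathbb N_0$, $\mathcal H_r(z_1,\ldots,z_n)=\sum_{r_1+\cdots+r_n=r,\ r_i\in\mathbb N_0}z_1^{r_1}\cdots z_n^{r_n}$ is the complete homogeneous symmetric polynomial of degree $r$ (with $\mathcal H_0=1$). $\mathcal H_r(\vec\zeta_m^{\,*})$ denotes $\mathcal H_r$ evaluated at the $\varphi(m)$ primitive $m$th roots of unity $\zeta_m^j$, $1\le j\le m$, $(j,m)=1$. *)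

theory Defs
  imports
    Complex_Main
    "HOL-Library.FuncSet"
    "HOL-Computational_Algebra.Polynomial"
    "HOL-Number_Theory.Totient"
begin

definition root_of_unity :: "nat \<Rightarrow> complex"  (\<open>\<zeta>\<close>) where
  "\<zeta> n = exp (2 * of_real pi * \<i> / of_nat n)"

definition cyclotomic :: "nat \<Rightarrow> complex poly"  (\<open>\<Phi>\<close>) where
  "\<Phi> n = (\<Prod>j | 1 \<le> j \<and> j \<le> n \<and> coprime j n. [:- (\<zeta> n ^ j), 1:])"

text \<open>
  Coefficients are counted from the leading one: \<open>cyclotomic_coeff n s\<close> is the coefficient of
  \<open>z\<close> to the power \<open>totient n - s\<close>, as \<open>cyclotomic_expansion\<close> below states. It is only
  meaningful for \<open>s \<le> totient n\<close>, because the subtraction is truncated.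
\<close>

definition cyclotomic_coeff :: "nat \<Rightarrow> nat \<Rightarrow> complex" where
  "cyclotomic_coeff n s = coeff (\<Phi> n) (totient n - s)"

text \<open>
  The complete homogeneous symmetric polynomial of degree \<open>r\<close> in variables indexed by a finite
  set \<open>I\<close>, evaluated at the family \<open>z\<close>. Exponent vectors are taken in \<open>extensional I\<close>, so that
  each one is counted once.
\<close>

definition complete_homogeneous :: "nat \<Rightarrow> 'i set \<Rightarrow> ('i \<Rightarrow> 'a::comm_semiring_1) \<Rightarrow> 'a" where
  "complete_homogeneous r I z =
     (\<Sum>e | e \<in> extensional I \<and> (\<Sum>i\<in>I. e i) = r. \<Prod>i\<in>I. z i ^ e i)"

definition complete_homogeneous_primitive :: "nat \<Rightarrow> nat \<Rightarrow> complex" where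
  "complete_homogeneous_primitive r m =
     complete_homogeneous r {j. 1 \<le> j \<and> j \<le> m \<and> coprime j m} (\<lambda>j. \<zeta> m ^ j)"

lemma finite_exponent_vectors:
  assumes "finite I"
  shows "finite {e \<in> extensional I. (\<Sum>i\<in>I. e i) = (r::nat)}"
proof (rule finite_subset)
  show "{e \<in> extensional I. (\<Sum>i\<in>I. e i) = r} \<subseteq> I \<rightarrow>\<^sub>E {..r}"
    using assms by (auto simp: PiE_def intro: member_le_sum)
qed (use assms in \<open>auto intro: finite_PiE\<close>)

lemma degree_cyclotomic: "degree (\<Phi> n) = totient n"
proof -
  have "{j. 1 \<le> j \<and> j \<le> n \<and> coprime j n} = totatives n"
    by (auto simp: totatives_def)
  then show ?thesis
    unfolding cyclotomic_def totient_def
    by (subst degree_prod_eq_sum_degree) auto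
qed

lemma cyclotomic_expansion:
  "poly (\<Phi> n) z = (\<Sum>s\<le>totient n. cyclotomic_coeff n s * z ^ (totient n - s))"
  unfolding poly_altdef degree_cyclotomic cyclotomic_coeff_def
  by (rule sum.reindex_bij_witness[of _ "\<lambda>s. totient n - s" "\<lambda>s. totient n - s"]) auto

lemma totient_mult_prime:
  assumes "prime p" and "\<not> p dvd m"
  shows "totient (m * p) = (p - 1) * totient m"
proof -
  have "coprime m p"
    using prime_imp_coprime[OF assms] by (simp add: coprime_commute)
  then show ?thesis
    using assms(1) by (simp add: totient_mult_coprime totient_prime)
qed

end

theory Submission
  imports
    Defs
    "HOL-Computational_Algebra.Polynomial_FPS"
    "HOL-Analysis.Complex_Transcendental"
begin

text \<open>
  Comparing roots gives \<open>\<Phi> m (z ^ p) = \<Phi> (m * p) z * \<Phi> m z\<close>. After reversing the polynomials,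
  \<open>\<Phi> m\<close> becomes the product of the factors \<open>1 - \<zeta> m ^ j * z\<close>, whose inverse as a formal power
  series is the generating function of the complete homogeneous symmetric polynomials. Multiplying
  the reversed identity by this inverse and comparing coefficients yields the formula.
\<close>

section \<open>Generating function of the complete homogeneous symmetric polynomials\<close>

lemma complete_homogeneous_empty: "complete_homogeneous r {} z = (if r = 0 then 1 else 0)"
proof -
  have "{e \<in> extensional {}. (\<Sum>i\<in>{}. e i) = r} =
      (if r = 0 then {\<lambda>_. undefined} else ({} :: ('i \<Rightarrow> nat) set))"
    by auto
  then show ?thesis
    by (simp add: complete_homogeneous_def)
qed

text \<open>Monomials are sorted by the exponent \<open>k\<close> of the new variable
  \<open>z a\<close>; what remains is a monomial in the old variables of degree
  \<open>r - k\<close>. This is the Cauchy product needed for the induction on the set of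
  variables.\<close>

lemma complete_homogeneous_insert:
  assumes "finite I" "a \<notin> I"
  shows "complete_homogeneous r (insert a I) z =
    (\<Sum>k\<le>r. z a ^ k * complete_homogeneous (r - k) I z)"
proof -
  define V where "V n = {e \<in> extensional I. (\<Sum>i\<in>I. e i) = (n::nat)}" for n
  have sum_upd: "(\<Sum>i\<in>I. (e(a := k)) i) = (\<Sum>i\<in>I. e i)"
    and prod_upd: "(\<Prod>i\<in>I. z i ^ (e(a := k)) i) = (\<Prod>i\<in>I. z i ^ e i)" for e :: "_ \<Rightarrow> nat" and k
    using assms(2) by (auto intro!: sum.cong prod.cong)
  have "(\<Sum>k\<le>r. z a ^ k * complete_homogeneous (r - k) I z) =
      (\<Sum>k\<le>r. \<Sum>e\<in>V (r - k). z a ^ k * (\<Prod>i\<in>I. z i ^ e i))"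
    by (simp add: complete_homogeneous_def V_def sum_distrib_left)
  also have "\<dots> = (\<Sum>(k, e)\<in>(SIGMA k:{..r}. V (r - k)). z a ^ k * (\<Prod>i\<in>I. z i ^ e i))"
    using finite_exponent_vectors[OF assms(1)] by (intro sum.Sigma) (auto simp: V_def)
  also have "\<dots> = (\<Sum>e | e \<in> extensional (insert a I) \<and> (\<Sum>i\<in>insert a I. e i) = r.
      \<Prod>i\<in>insert a I. z i ^ e i)"
  \<comment> \<open>Splitting off the exponent at \<open>a\<close> must reset that entry to
    \<open>undefined\<close>, so that the remaining vector is again extensional on
    \<open>I\<close>.\<close>
  proof (rule sum.reindex_bij_witness[of _ "\<lambda>e. (e a, e(a := undefined))" "\<lambda>(k, e). e(a := k)"])
    fix q assume "q \<in> (SIGMA k:{..r}. V (r - k))"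
    then obtain k e where q: "q = (k, e)" "k \<le> r" "e \<in> extensional I" "sum e I = r - k"
      by (auto simp: V_def)
    have "e(a := undefined) = e"
      using q(3) assms(2) by (auto simp: extensional_def fun_eq_iff)
    then show "(\<lambda>e. (e a, e(a := undefined))) (case q of (k, e) \<Rightarrow> e(a := k)) = q"
      by (simp add: q(1))
    show "(case q of (k, e) \<Rightarrow> e(a := k)) \<in>
        {e \<in> extensional (insert a I). (\<Sum>i\<in>insert a I. e i) = r}"
      using q assms sum_upd[of e k] by (auto simp: extensional_def)
    show "(\<Prod>i\<in>insert a I. z i ^ (case q of (k, e) \<Rightarrow> e(a := k)) i) =
        (case q of (k, e) \<Rightarrow> z a ^ k * (\<Prod>i\<in>I. z i ^ e i))"
      using assms prod_upd[of e k] by (simp add: q(1))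
  next
    fix e assume e: "e \<in> {e \<in> extensional (insert a I). (\<Sum>i\<in>insert a I. e i) = r}"
    show "(case (e a, e(a := undefined)) of (k, e) \<Rightarrow> e(a := k)) = e"
      by simp
    show "(e a, e(a := undefined)) \<in> (SIGMA k:{..r}. V (r - k))"
      using e assms sum_upd[of e undefined] by (auto simp: V_def extensional_def)
  qed
  finally show ?thesis
    by (simp add: complete_homogeneous_def)
qed

text \<open>Induction on \<open>I\<close>: adding a variable multiplies the generating function by a
  geometric series, which is the inverse of the new linear factor.\<close>

lemma complete_homogeneous_generating_function:
  fixes z :: "'i \<Rightarrow> 'a::field"
  assumes "finite I"
  shows "(\<Prod>i\<in>I. 1 - fps_const (z i) * fps_X) * Abs_fps (\<lambda>r. complete_homogeneous r I z) = 1"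
  using assms
proof (induction I)
  case empty
  show ?case
    by (rule fps_ext) (simp add: complete_homogeneous_empty)
next
  case (insert a I)
  have geometric: "(1 - fps_const (z a) * fps_X) * Abs_fps (\<lambda>k. z a ^ k) = 1"
  proof (rule fps_ext)
    fix n
    show "fps_nth ((1 - fps_const (z a) * fps_X) * Abs_fps (\<lambda>k. z a ^ k)) n = fps_nth 1 n"
      by (cases n) (simp_all add: left_diff_distrib mult.assoc)
  qed
  have split: "Abs_fps (\<lambda>r. complete_homogeneous r (insert a I) z) =
      Abs_fps (\<lambda>k. z a ^ k) * Abs_fps (\<lambda>r. complete_homogeneous r I z)"
    by (rule fps_ext)
      (simp add: complete_homogeneous_insert[OF insert.hyps] fps_mult_nth atLeast0AtMost)
  have "(\<Prod>i\<in>insert a I. 1 - fps_const (z i) * fps_X) *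
      Abs_fps (\<lambda>r. complete_homogeneous r (insert a I) z) =
      ((1 - fps_const (z a) * fps_X) * Abs_fps (\<lambda>k. z a ^ k)) *
      ((\<Prod>i\<in>I. 1 - fps_const (z i) * fps_X) * Abs_fps (\<lambda>r. complete_homogeneous r I z))"
    using insert.hyps by (simp add: split mult_ac)
  then show ?case
    by (simp add: geometric insert.IH)
qed

section \<open>Substitution of a power of the variable, and its interplay with reversal\<close>

lemma coeff_pcompose_monom_1:
  fixes q :: "'a::comm_ring_1 poly"
  assumes "p > 0"
  shows "coeff (q \<circ>\<^sub>p monom 1 p) n = (if p dvd n then coeff q (n div p) else 0)"
proof (induction q arbitrary: n)
  case (pCons a q)
  \<comment> \<open>Horner's form a + z^p * q(z^p): for \<open>n \<ge> p\<close> the induction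
    hypothesis is applied at \<open>n - p\<close>, which lowers \<open>n div p\<close> by one and
    keeps divisibility by \<open>p\<close>.\<close>
  have "coeff (pCons a q \<circ>\<^sub>p monom 1 p) n =
      coeff [:a:] n + (if n < p then 0 else coeff (q \<circ>\<^sub>p monom 1 p) (n - p))"
    by (simp add: pcompose_pCons coeff_monom_mult)
  also have "\<dots> = (if p dvd n then coeff (pCons a q) (n div p) else 0)"
  proof (cases "n < p")
    case True
    then show ?thesis
      by (cases "n = 0") (auto simp: coeff_pCons dest: dvd_imp_le split: nat.splits)
  next
    case False
    then have "n div p = Suc ((n - p) div p)" "p dvd n - p \<longleftrightarrow> p dvd n"
      using assms by (simp_all add: le_div_geq dvd_minus_self)
    then show ?thesis
      using False assms by (auto simp: pCons.IH coeff_pCons split: nat.splits)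
  qed
  finally show ?case .
qed auto

text \<open>The composed polynomial has degree \<open>degree q * p\<close>, so reversal maps
  exponent \<open>s * p\<close> to \<open>(degree q - s) * p\<close> and keeps non-multiples of
  \<open>p\<close> among the non-multiples.\<close>

lemma reflect_poly_pcompose_monom_1:
  fixes q :: "'a::idom poly"
  assumes "p > 0"
  shows "reflect_poly (q \<circ>\<^sub>p monom 1 p) = reflect_poly q \<circ>\<^sub>p monom 1 p"
proof (rule poly_eqI)
  fix n
  have deg: "degree (q \<circ>\<^sub>p monom 1 p) = degree q * p"
    by (simp add: degree_pcompose degree_monom_eq)
  show "coeff (reflect_poly (q \<circ>\<^sub>p monom 1 p)) n = coeff (reflect_poly q \<circ>\<^sub>p monom 1 p) n"
  proof (cases "p dvd n")
    case True
    then obtain s where "n = s * p"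
      by (auto simp: dvd_def mult.commute)
    then show ?thesis
      using assms
      by (simp add: coeff_reflect_poly coeff_pcompose_monom_1 deg flip: diff_mult_distrib)
  next
    case False
    then have "\<not> p dvd degree q * p - n" if "n \<le> degree q * p"
      using that by (metis dvd_diff_nat diff_diff_cancel dvd_triv_right)
    then show ?thesis
      using False assms by (simp add: coeff_reflect_poly coeff_pcompose_monom_1 deg)
  qed
qed

section \<open>Roots of unity and the zeros of cyclotomic polynomials\<close>

lemma cyclotomic_altdef: "\<Phi> n = (\<Prod>j\<in>totatives n. [:- (\<zeta> n ^ j), 1:])"
  unfolding cyclotomic_def by (rule prod.cong) (auto simp: totatives_def)

lemma complete_homogeneous_primitive_altdef:
  "complete_homogeneous_primitive r m = complete_homogeneous r (totatives m) (\<lambda>j. \<zeta> m ^ j)"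
proof -
  have "{j. 1 \<le> j \<and> j \<le> m \<and> coprime j m} = totatives m"
    by (auto simp: totatives_def)
  then show ?thesis
    by (simp add: complete_homogeneous_primitive_def)
qed

lemma root_of_unity_nonzero: "\<zeta> n \<noteq> 0"
  by (simp add: root_of_unity_def)

lemma root_of_unity_power_eq_iff:
  assumes "n \<ge> 1"
  shows "\<zeta> n ^ i = \<zeta> n ^ j \<longleftrightarrow> i mod n = j mod n"
proof -
  have "\<zeta> n ^ i = exp (2 * of_real pi * \<i> * of_nat i / of_nat n)" for i
    by (simp add: root_of_unity_def mult_ac flip: exp_of_nat_mult)
  then show ?thesis
    using complex_root_unity_eq[OF assms] by simp
qed

lemma root_of_unity_mult_power:
  assumes "p > 0"
  shows "\<zeta> (m * p) ^ p = \<zeta> m"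
  using assms by (simp add: root_of_unity_def flip: exp_of_nat_mult)

lemma inj_on_root_of_unity_power: "inj_on (\<lambda>j. \<zeta> n ^ j) (totatives n)"
proof (rule inj_onI)
  fix i j assume ij: "i \<in> totatives n" "j \<in> totatives n" "\<zeta> n ^ i = \<zeta> n ^ j"
  then have "i mod n = j mod n"
    by (subst root_of_unity_power_eq_iff[symmetric]) (auto simp: totatives_def)
  \<comment> \<open>The range 1..n contains exactly one representative of each residue class, with
    \<open>n\<close> itself standing for residue 0.\<close>
  moreover have "0 < i" "i \<le> n" "0 < j" "j \<le> n"
    using ij by (auto simp: totatives_def)
  ultimately show "i = j"
    by (metis le_neq_implies_less mod_less mod_self less_irrefl)
qed

text \<open>The exponent is not confined to the range 1..m, since later it is a totative of
  \<open>m * p\<close> or a multiple of \<open>p\<close>; it is reduced modulo \<open>m\<close> to a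
  totative.\<close>

lemma poly_cyclotomic_eq_0:
  assumes "m \<ge> 1" "coprime i m"
  shows "poly (\<Phi> m) (\<zeta> m ^ i) = 0"
proof -
  obtain j where "j \<in> totatives m" "i mod m = j mod m"
  \<comment> \<open>Residue 0 is never a totative. Coprimality excludes it except for
    \<open>m = 1\<close>, where the representative 1 is taken instead.\<close>
  proof (cases "m = 1")
    case True
    then show ?thesis
      using that[of 1] by simp
  next
    case False
    then have "i mod m \<noteq> 0"
      using assms by (metis coprime_0_left_iff coprime_mod_left_iff not_one_le_zero nat_dvd_1_iff_1)
    then show ?thesis
      using assms that[of "i mod m"] by (auto simp: totatives_def less_imp_le)
  qed
  then show ?thesis
    using assms by (force simp: cyclotomic_altdef poly_prod root_of_unity_power_eq_iff)
qed

lemma lead_coeff_cyclotomic: "lead_coeff (\<Phi> n) = 1"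
  by (simp add: cyclotomic_altdef lead_coeff_prod)

lemma coeff_0_cyclotomic: "coeff (\<Phi> n) 0 \<noteq> 0"
  by (simp add: cyclotomic_altdef root_of_unity_nonzero poly_prod flip: poly_0_coeff_0)

text \<open>Both sides are monic of degree \<open>totient m * p\<close>, so it suffices that they
  agree at that many distinct points. These are the primitive roots of unity of order
  \<open>m * p\<close> and of order \<open>m\<close>, at which both sides vanish.\<close>

lemma cyclotomic_pcompose_prime:
  assumes "prime p" "m \<ge> 1" "\<not> p dvd m"
  shows "\<Phi> m \<circ>\<^sub>p monom 1 p = \<Phi> (m * p) * \<Phi> m"
proof -
  have p: "p > 0"
    using assms(1) by (simp add: prime_gt_0_nat)
  have coprime: "coprime p m"
    using assms by (simp add: prime_imp_coprime)
  define A where "A = (\<lambda>j. \<zeta> (m * p) ^ j) ` totatives (m * p)"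
  define B where "B = (\<lambda>j. \<zeta> m ^ j) ` totatives m"
  have "A \<inter> B = {}"
  proof (rule ccontr)
    assume "A \<inter> B \<noteq> {}"
    then obtain i j where i: "i \<in> totatives (m * p)" and "\<zeta> (m * p) ^ i = \<zeta> m ^ j"
      by (auto simp: A_def B_def)
    \<comment> \<open>A common point is written in two ways as a power of the same root of unity.
      The exponents are then congruent modulo \<open>m * p\<close>, which forces \<open>p\<close> to
      divide \<open>i\<close>, although \<open>i\<close> is coprime to \<open>m * p\<close>.\<close>
    then have "\<zeta> (m * p) ^ i = \<zeta> (m * p) ^ (p * j)"
      by (simp add: power_mult root_of_unity_mult_power[OF p])
    then have "i mod (m * p) = (p * j) mod (m * p)"
      using assms(2) p by (subst (asm) root_of_unity_power_eq_iff) auto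
    then have "p dvd i"
      by (metis dvd_mod_iff dvd_triv_left dvd_triv_right)
    with i assms(1) show False
      by (auto simp: totatives_def dest: coprime_common_divisor_nat)
  qed
  moreover have "card A = (p - 1) * totient m" "card B = totient m"
    using inj_on_root_of_unity_power totient_mult_prime[OF assms(1,3)]
    by (simp_all add: A_def B_def card_image flip: totient_def)
  ultimately have "card (A \<union> B) = (p - 1) * totient m + totient m"
    by (subst card_Un_disjoint) (simp_all add: A_def B_def)
  also have totient_sum: "\<dots> = totient m * p"
    using p by (cases p) auto
  finally have card: "card (A \<union> B) = totient m * p" .
  have deg: "degree (\<Phi> m \<circ>\<^sub>p monom 1 p) = totient m * p"
    by (simp add: degree_pcompose degree_monom_eq degree_cyclotomic)
  have nz: "\<Phi> n \<noteq> 0" for n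
    using coeff_0_cyclotomic[of n] by auto
  have deg': "degree (\<Phi> (m * p) * \<Phi> m) = totient m * p"
    using totient_sum
    by (simp add: degree_mult_eq nz degree_cyclotomic totient_mult_prime[OF assms(1,3)])
  show ?thesis
  proof (rule poly_eqI_degree_lead_coeff[where n = "totient m * p" and A = "A \<union> B"])
    have "lead_coeff (\<Phi> m \<circ>\<^sub>p monom 1 p) = 1"
      using p by (subst lead_coeff_comp)
        (simp_all add: degree_monom_eq lead_coeff_monom lead_coeff_cyclotomic)
    moreover have "lead_coeff (\<Phi> (m * p) * \<Phi> m) = 1"
      unfolding lead_coeff_mult lead_coeff_cyclotomic by simp
    ultimately show "coeff (\<Phi> m \<circ>\<^sub>p monom 1 p) (totient m * p) =
        coeff (\<Phi> (m * p) * \<Phi> m) (totient m * p)"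
      unfolding deg deg' by simp
  next
    fix w assume "w \<in> A \<union> B"
    then show "poly (\<Phi> m \<circ>\<^sub>p monom 1 p) w = poly (\<Phi> (m * p) * \<Phi> m) w"
    proof
      assume "w \<in> A"
      then obtain i where i: "i \<in> totatives (m * p)" and w: "w = \<zeta> (m * p) ^ i"
        by (auto simp: A_def)
      \<comment> \<open>The p-th power of \<open>w\<close> is a primitive m-th root of unity, a zero
        of \<open>\<Phi> m\<close>; on the right the factor \<open>\<Phi> (m * p)\<close>
        vanishes.\<close>
      have "w ^ p = (\<zeta> (m * p) ^ p) ^ i"
        by (simp add: w mult.commute flip: power_mult)
      then have "w ^ p = \<zeta> m ^ i"
        by (simp add: root_of_unity_mult_power[OF p])
      moreover have "coprime i m" "coprime i (m * p)"
        using i by (auto simp: totatives_def)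
      ultimately show ?thesis
        using assms(2) p poly_cyclotomic_eq_0[of m i] poly_cyclotomic_eq_0[of "m * p" i]
        by (simp add: poly_pcompose poly_monom w)
    next
      assume "w \<in> B"
      then obtain j where j: "j \<in> totatives m" and w: "w = \<zeta> m ^ j"
        by (auto simp: B_def)
      \<comment> \<open>Since \<open>p\<close> is coprime to \<open>m\<close>, raising to the p-th
        power keeps primitive m-th roots primitive; on the right the factor \<open>\<Phi> m\<close>
        vanishes.\<close>
      have "coprime j m" "coprime (j * p) m"
        using j coprime by (auto simp: totatives_def)
      then show ?thesis
        using assms(2) poly_cyclotomic_eq_0[of m j] poly_cyclotomic_eq_0[of m "j * p"]
        by (simp add: poly_pcompose poly_monom w power_mult)
    qed
  qed (use card deg deg' in simp_all)
qed

section \<open>Reversed cyclotomic polynomials and comparison of coefficients\<close>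

lemma cyclotomic_coeff_conv_reflect_poly:
  assumes "s \<le> totient n"
  shows "cyclotomic_coeff n s = coeff (reflect_poly (\<Phi> n)) s"
  using assms by (simp add: cyclotomic_coeff_def coeff_reflect_poly degree_cyclotomic)

lemma reflect_cyclotomic_generating_function:
  "fps_of_poly (reflect_poly (\<Phi> m)) * Abs_fps (\<lambda>r. complete_homogeneous_primitive r m) = 1"
proof -
  have "reflect_poly [:- w, 1:] = [:1, - w:]" if "w \<noteq> 0" for w :: complex
    using that by (simp add: reflect_poly_def)
  then have "reflect_poly (\<Phi> m) = (\<Prod>j\<in>totatives m. [:1, - (\<zeta> m ^ j):])"
    by (simp add: cyclotomic_altdef reflect_poly_prod root_of_unity_nonzero)
  then have "fps_of_poly (reflect_poly (\<Phi> m)) =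
      (\<Prod>j\<in>totatives m. 1 - fps_const (\<zeta> m ^ j) * fps_X)"
    by (simp add: fps_of_poly_prod fps_of_poly_linear' flip: fps_const_neg)
  then show ?thesis
    using complete_homogeneous_generating_function[of "totatives m" "\<lambda>j. \<zeta> m ^ j"]
    by (simp add: complete_homogeneous_primitive_altdef)
qed

theorem theorem1p2:
  fixes p m k :: nat
  assumes "prime p" and "m \<ge> 1" and "\<not> p dvd m"
    and "k \<le> (p - 1) * totient m"
  shows "cyclotomic_coeff (m * p) k =
    (\<Sum>s = 0..k div p. cyclotomic_coeff m s * complete_homogeneous_primitive (k - s * p) m)"
proof -
  have p: "p > 0"
    using assms(1) by (simp add: prime_gt_0_nat)
  define R where "R n = reflect_poly (\<Phi> n)" for n
  define H where "H r = complete_homogeneous_primitive r m" for r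
  have "R m \<circ>\<^sub>p monom 1 p = R (m * p) * R m"
    unfolding R_def reflect_poly_mult[symmetric] cyclotomic_pcompose_prime[OF assms(1-3), symmetric]
    using p by (simp add: reflect_poly_pcompose_monom_1)
  then have "fps_of_poly (R m \<circ>\<^sub>p monom 1 p) * Abs_fps H =
      fps_of_poly (R (m * p)) * (fps_of_poly (R m) * Abs_fps H)"
    by (simp add: fps_of_poly_mult mult.assoc)
  also have "\<dots> = fps_of_poly (R (m * p))"
    using reflect_cyclotomic_generating_function[of m] by (simp add: R_def H_def[abs_def])
  finally have "coeff (R (m * p)) k = fps_nth (fps_of_poly (R m \<circ>\<^sub>p monom 1 p) * Abs_fps H) k"
    by simp
  also have "\<dots> = (\<Sum>i = 0..k. coeff (R m \<circ>\<^sub>p monom 1 p) i * H (k - i))"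
    by (simp add: fps_mult_nth)
  \<comment> \<open>Only multiples of \<open>p\<close> survive in the convolution, because the first
    factor is a polynomial in z^p.\<close>
  also have "\<dots> = (\<Sum>i\<in>(\<lambda>s. s * p) ` {0..k div p}. coeff (R m \<circ>\<^sub>p monom 1 p) i * H (k - i))"
  proof (rule sum.mono_neutral_right)
    show "(\<lambda>s. s * p) ` {0..k div p} \<subseteq> {0..k}"
      using p by (auto simp: less_eq_div_iff_mult_less_eq)
    show "\<forall>i\<in>{0..k} - (\<lambda>s. s * p) ` {0..k div p}. coeff (R m \<circ>\<^sub>p monom 1 p) i * H (k - i) = 0"
    proof
      fix i assume i: "i \<in> {0..k} - (\<lambda>s. s * p) ` {0..k div p}"
      have "\<not> p dvd i"
      proof
        assume "p dvd i"
        then have "i = (i div p) * p" by simp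
        moreover have "i div p \<in> {0..k div p}"
          using i by (simp add: div_le_mono)
        ultimately show False
          using i by blast
      qed
      then show "coeff (R m \<circ>\<^sub>p monom 1 p) i * H (k - i) = 0"
        using p by (simp add: coeff_pcompose_monom_1)
    qed
  qed simp
  also have "\<dots> = (\<Sum>s = 0..k div p. coeff (R m) s * H (k - s * p))"
    using p by (subst sum.reindex) (auto simp: inj_on_def coeff_pcompose_monom_1)
  also have "\<dots> = (\<Sum>s = 0..k div p. cyclotomic_coeff m s * H (k - s * p))"
  proof (rule sum.cong)
    \<comment> \<open>The bound on \<open>k\<close> gives \<open>s \<le> totient m\<close>. Past
      that index truncated subtraction would make \<open>cyclotomic_coeff m s\<close> the nonzero
      constant term, whereas the reversed polynomial has coefficient 0 there.\<close>
    fix s assume "s \<in> {0..k div p}"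
    then have "s * p \<le> k"
      using p by (simp add: less_eq_div_iff_mult_less_eq)
    also have "k \<le> totient m * p"
      using assms(4) by (metis diff_le_self le_trans mult.commute mult_le_mono2)
    finally have "s \<le> totient m"
      using p by simp
    then show "coeff (R m) s * H (k - s * p) = cyclotomic_coeff m s * H (k - s * p)"
      by (simp add: R_def cyclotomic_coeff_conv_reflect_poly)
  qed simp
  \<comment> \<open>Here the bound on \<open>k\<close> is the degree of
    \<open>\<Phi> (m * p)\<close>.\<close>
  also have "coeff (R (m * p)) k = cyclotomic_coeff (m * p) k"
    using assms(4) totient_mult_prime[OF assms(1,3)]
    by (simp add: R_def cyclotomic_coeff_conv_reflect_poly)
  finally show ?thesis
    by (simp add: H_def)
qed

end
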